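(* Let $\varphi$ be a Musielak--Orlicz function on $\Omega\times[0,\infty)$ which is of uniformly lower type $p_\varphi^-$ for some $p_\varphi^-\in(0,\infty)$ and of uniformly upper type $p_\varphi^+$ for some $p_\varphi^+\in(0,\infty)$, and such that $\int_\Omega\varphi(x,t)\,d\mathbb P(x)<\infty$ for every $t\in(0,\infty)$. Let $\{h_n\}_{n\in\mathbb N}$ be a sequence of measurable functions that converges $\mathbb P$-almost everywhere to a measurable function $h$. Suppose that there exists a measurable function $g\in W\mathcal L_\varphi(\Omega)$ such that $|h_n|$ is pointwise $\mathbb P$-almost everywhere bounded by $g$ for any $n\in\mathbb N$. Then $$\lim_{n\to\infty}\|h_n-h\|_{WL_\varphi(\Omega)}=0.$$
   Context: $(\Omega,\mathcal F,\mathbb P)$ is a probability space. $\varphi:\Omega\times[0,\infty)\to[0,\infty)$ is a Musielak--Orlicz function if $\varphi(\cdot,t)$ is measurable for each $t\in[0,\infty)$ and, for each $x\in\Omega$, $\varphi(x,\cdot)$ is non-decreasing, $\varphi(x,0)=0$, $\varphi(x,t)>0$ for $t\in(0,\infty)$, and $\lim_{t\to\infty}\varphi(x,t)=\infty$. It is of uniformly lower (resp. upper) type $p\in(0,\infty)$ if there is a constant $C_{(p)}>0$ with $\varphi(x,st)\le C_{(p)}s^p\varphi(x,t)$ for all $x\in\Omega$, $t\in[0,\infty)$ and $s\in(0,1)$ (resp. $s\in[1,\infty)$). For measurable $E\subseteq\Omega$, $\varphi(E,t):=\int_E\varphi(x,t)\,d\mathbb P(x)$. For measurable $f$, $\|f\|_{WL_\varphi(\Omega)}:=\inf\{\lambda\in(0,\infty):\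 \sup_{\alpha\in(0,\infty)}\varphi(\{x\in\Omega:|f(x)|>\alpha\},\alpha/\lambda)\le1\}$, and $WL_\varphi(\Omega)$ is the set of measurable $f$ with $\|f\|_{WL_\varphi(\Omega)}<\infty$. Finally, $W\mathcal L_\varphi(\Omega):=\{f\in WL_\varphi(\Omega):\ \lim_{n\to\infty}\|f\mathbf 1_{\{x\in\Omega:\,|f(x)|>n\}}\|_{WL_\varphi(\Omega)}=0\}$. *)

theory Defs
  imports "HOL-Probability.Probability"
begin

text \<open>
  A function on \<open>\<Omega> \<times> [0,\<infty>)\<close> is rendered as \<open>'a \<Rightarrow> real \<Rightarrow> real\<close>, with \<open>\<Omega> = space M\<close>; values at
  points outside \<open>space M\<close> and at negative arguments are unconstrained and never used.
\<close>

definition Musielak_Orlicz :: "'a measure \<Rightarrow> ('a \<Rightarrow> real \<Rightarrow> real) \<Rightarrow> bool" where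
  "Musielak_Orlicz M \<phi> \<longleftrightarrow>
     (\<forall>x\<in>space M. \<forall>t\<ge>0. 0 \<le> \<phi> x t) \<and>
     (\<forall>t\<ge>0. (\<lambda>x. \<phi> x t) \<in> borel_measurable M) \<and>
     (\<forall>x\<in>space M.
        mono_on {0..} (\<phi> x) \<and> \<phi> x 0 = 0 \<and> (\<forall>t>0. 0 < \<phi> x t) \<and>
        filterlim (\<phi> x) at_top at_top)"

definition uniformly_lower_type :: "'a measure \<Rightarrow> ('a \<Rightarrow> real \<Rightarrow> real) \<Rightarrow> real \<Rightarrow> bool" where
  "uniformly_lower_type M \<phi> p \<longleftrightarrow>
     (\<exists>C>0. \<forall>x\<in>space M. \<forall>t\<ge>0. \<forall>s\<in>{0<..<1}. \<phi> x (s * t) \<le> C * s powr p * \<phi> x t)"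

definition uniformly_upper_type :: "'a measure \<Rightarrow> ('a \<Rightarrow> real \<Rightarrow> real) \<Rightarrow> real \<Rightarrow> bool" where
  "uniformly_upper_type M \<phi> p \<longleftrightarrow>
     (\<exists>C>0. \<forall>x\<in>space M. \<forall>t\<ge>0. \<forall>s\<in>{1..}. \<phi> x (s * t) \<le> C * s powr p * \<phi> x t)"

text \<open>\<open>\<phi>(E,t)\<close> takes values in \<open>[0,\<infty>]\<close>, so it is a nonnegative Lebesgue integral.\<close>

definition MO_measure :: "'a measure \<Rightarrow> ('a \<Rightarrow> real \<Rightarrow> real) \<Rightarrow> 'a set \<Rightarrow> real \<Rightarrow> ennreal" where
  "MO_measure M \<phi> E t = (\<integral>\<^sup>+x\<in>E. ennreal (\<phi> x t) \<partial>M)"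

text \<open>The infimum is taken in \<open>[0,\<infty>]\<close>; it is \<open>\<infty>\<close> if no \<open>l\<close> is admissible.\<close>

definition WL_norm :: "'a measure \<Rightarrow> ('a \<Rightarrow> real \<Rightarrow> real) \<Rightarrow> ('a \<Rightarrow> real) \<Rightarrow> ennreal" where
  "WL_norm M \<phi> f =
     Inf {ennreal l | l. 0 < l \<and>
       (SUP \<alpha>\<in>{0<..}. MO_measure M \<phi> {x \<in> space M. \<bar>f x\<bar> > \<alpha>} (\<alpha> / l)) \<le> 1}"

definition WL :: "'a measure \<Rightarrow> ('a \<Rightarrow> real \<Rightarrow> real) \<Rightarrow> ('a \<Rightarrow> real) set" where
  "WL M \<phi> = {f \<in> borel_measurable M. WL_norm M \<phi> f < top}"

definition WL_abs_cont :: "'a measure \<Rightarrow> ('a \<Rightarrow> real \<Rightarrow> real) \<Rightarrow> ('a \<Rightarrow> real) set" where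
  "WL_abs_cont M \<phi> =
     {f \<in> WL M \<phi>.
       (\<lambda>n::nat. WL_norm M \<phi> (\<lambda>x. f x * indicator {x \<in> space M. \<bar>f x\<bar> > real n} x)) \<longlonglongrightarrow> 0}"

end

theory Submission
  imports Defs
begin

text \<open>
  Put \<open>d = h\<^sub>n - h\<close>, so that \<open>\<bar>d\<bar> \<le> 2 g\<close> almost everywhere, and fix \<open>\<epsilon> > 0\<close>. The quantity
  \<open>\<phi>({\<bar>d\<bar> > \<alpha>}, \<alpha>/\<epsilon>)\<close> is at most 1 for three reasons, according to the size of \<open>\<alpha>\<close>.
  For large \<open>\<alpha>\<close> it is controlled by the small norm of the truncation of \<open>g\<close> at a high level.
  For small \<open>\<alpha>\<close> it is at most \<open>\<phi>(\<Omega>, \<alpha>/\<epsilon>)\<close>, which tends to 0 with \<open>\<alpha>\<close> by the lower type property.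
  On the remaining range \<open>\<eta> < \<alpha> < K\<close> it is at most \<open>\<phi>({\<bar>d\<bar> > \<eta>}, K/\<epsilon>)\<close>, which tends to 0 as
  \<open>n \<rightarrow> \<infinity>\<close> by dominated convergence.
\<close>

text \<open>The inclusion is asked only almost everywhere because the domination by \<open>g\<close>
  holds only off a null set.\<close>

lemma MO_measure_mono_AE:
  assumes MO: "Musielak_Orlicz M \<phi>" and st: "0 \<le> s" "s \<le> t"
    and AB: "AE x in M. x \<in> A \<longrightarrow> x \<in> B"
  shows "MO_measure M \<phi> A s \<le> MO_measure M \<phi> B t"
  unfolding MO_measure_def
proof (rule nn_integral_mono_AE)
  show "AE x in M. ennreal (\<phi> x s) * indicator A x \<le> ennreal (\<phi> x t) * indicator B x"
    using AB AE_space
  proof eventually_elim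
    case (elim x)
    have "mono_on {0..} (\<phi> x)"
      using MO elim by (auto simp: Musielak_Orlicz_def)
    then have "\<phi> x s \<le> \<phi> x t"
      using st by (auto elim: mono_onD)
    then show ?case
      using elim by (auto simp: indicator_def intro: ennreal_leI)
  qed
qed

lemma WL_norm_le:
  assumes "0 < l" and "\<And>\<alpha>. 0 < \<alpha> \<Longrightarrow> MO_measure M \<phi> {x \<in> space M. \<bar>f x\<bar> > \<alpha>} (\<alpha> / l) \<le> 1"
  shows "WL_norm M \<phi> f \<le> ennreal l"
  unfolding WL_norm_def using assms by (intro Inf_lower) (auto intro!: SUP_least)

text \<open>The infimum need not be attained, but a strict bound on it always yields an admissible
  \<open>l\<close> below \<open>d\<close>.\<close>

lemma WL_norm_lessE:
  assumes "WL_norm M \<phi> f < ennreal d"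
  obtains l where "0 < l" "l < d"
    "\<And>\<alpha>. 0 < \<alpha> \<Longrightarrow> MO_measure M \<phi> {x \<in> space M. \<bar>f x\<bar> > \<alpha>} (\<alpha> / l) \<le> 1"
proof -
  obtain l where l: "0 < l" "ennreal l < ennreal d"
    and sup: "(SUP \<alpha>\<in>{0<..}. MO_measure M \<phi> {x \<in> space M. \<bar>f x\<bar> > \<alpha>} (\<alpha> / l)) \<le> 1"
    using assms unfolding WL_norm_def Inf_less_iff by auto
  show thesis
  proof (rule that)
    show "l < d"
      using l by (simp add: ennreal_less_iff)
    show "MO_measure M \<phi> {x \<in> space M. \<bar>f x\<bar> > \<alpha>} (\<alpha> / l) \<le> 1" if "0 < \<alpha>" for \<alpha>
      using sup that by (auto simp: SUP_le_iff)
  qed (fact l)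
qed

text \<open>The lower type inequality at \<open>t = 1\<close>, integrated over the space, bounds the
  quantity by \<open>C * s powr p\<close> times a finite integral.\<close>

lemma MO_measure_space_tendsto_0:
  assumes MO: "Musielak_Orlicz M \<phi>" and p: "0 < p" and low: "uniformly_lower_type M \<phi> p"
    and fin: "(\<integral>\<^sup>+x. ennreal (\<phi> x 1) \<partial>M) < top"
  shows "(MO_measure M \<phi> (space M) \<longlongrightarrow> 0) (at_right 0)"
proof -
  obtain C where C: "0 < C"
    "\<And>x t s. x \<in> space M \<Longrightarrow> 0 \<le> t \<Longrightarrow> s \<in> {0<..<1} \<Longrightarrow> \<phi> x (s * t) \<le> C * s powr p * \<phi> x t"
    using low unfolding uniformly_lower_type_def by blast
  define I where "I = (\<integral>\<^sup>+x. ennreal (\<phi> x 1) \<partial>M)"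
  have meas: "(\<lambda>x. \<phi> x 1) \<in> borel_measurable M"
    using MO by (auto simp: Musielak_Orlicz_def)
  have "MO_measure M \<phi> (space M) s \<le> ennreal (C * s powr p) * I" if "s \<in> {0<..<1}" for s
  proof -
    have "MO_measure M \<phi> (space M) s \<le> (\<integral>\<^sup>+x. ennreal (C * s powr p) * ennreal (\<phi> x 1) \<partial>M)"
      unfolding MO_measure_def
    proof (rule nn_integral_mono)
      fix x assume x: "x \<in> space M"
      then have "\<phi> x s \<le> C * s powr p * \<phi> x 1"
        using C(2)[of x 1 s] that by simp
      then show "ennreal (\<phi> x s) * indicator (space M) x \<le> ennreal (C * s powr p) * ennreal (\<phi> x 1)"
        using x MO C(1) by (auto simp: Musielak_Orlicz_def ennreal_mult[symmetric] intro!: ennreal_leI)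
    qed
    also have "\<dots> = ennreal (C * s powr p) * I"
      unfolding I_def using meas by (intro nn_integral_cmult) auto
    finally show ?thesis .
  qed
  then have le: "\<forall>\<^sub>F s in at_right 0. MO_measure M \<phi> (space M) s \<le> ennreal (C * s powr p) * I"
    using eventually_at_right_real[of 0 1] by (auto elim!: eventually_mono)
  have lim: "((\<lambda>s. ennreal (C * s powr p) * I) \<longlongrightarrow> ennreal 0 * I) (at_right 0)"
  proof (rule tendsto_mult_ennreal)
    have "((\<lambda>s::real. s powr p) \<longlongrightarrow> 0) (at_right 0)"
      using p by (intro tendsto_zero_powrI[where b = p])
        (auto simp: eventually_at_filter)
    then have "((\<lambda>s. C * s powr p) \<longlongrightarrow> C * 0) (at_right 0)"
      by (intro tendsto_intros)
    then show "((\<lambda>s. ennreal (C * s powr p)) \<longlongrightarrow> ennreal 0) (at_right 0)"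
      by (intro tendsto_ennrealI) simp
  qed (use fin in \<open>auto simp: I_def\<close>)
  show ?thesis
    using tendsto_sandwich[OF always_eventually le tendsto_const[of 0]] lim by simp
qed

text \<open>Dominated convergence with majorant \<open>\<phi> x t\<close>: wherever
  \<open>f n x\<close> tends to 0, the indicator is eventually equal to 0.\<close>

lemma MO_measure_superlevel_tendsto_0:
  fixes f :: "nat \<Rightarrow> 'a \<Rightarrow> real"
  assumes MO: "Musielak_Orlicz M \<phi>" and t: "0 \<le> t" and c: "0 < c"
    and fin: "(\<integral>\<^sup>+x. ennreal (\<phi> x t) \<partial>M) < top"
    and [measurable]: "\<And>n. f n \<in> borel_measurable M"
    and lim: "AE x in M. (\<lambda>n. f n x) \<longlonglongrightarrow> 0"
  shows "(\<lambda>n. MO_measure M \<phi> {x \<in> space M. \<bar>f n x\<bar> > c} t) \<longlonglongrightarrow> 0"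
proof -
  have [measurable]: "(\<lambda>x. \<phi> x t) \<in> borel_measurable M"
    using MO t by (auto simp: Musielak_Orlicz_def)
  have "(\<lambda>n. \<integral>\<^sup>+x\<in>{x \<in> space M. \<bar>f n x\<bar> > c}. ennreal (\<phi> x t) \<partial>M) \<longlonglongrightarrow> (\<integral>\<^sup>+x. 0 \<partial>M)"
  proof (rule nn_integral_dominated_convergence[where w = "\<lambda>x. ennreal (\<phi> x t)"])
    show "AE x in M. (\<lambda>n. ennreal (\<phi> x t) * indicator {x \<in> space M. \<bar>f n x\<bar> > c} x) \<longlonglongrightarrow> 0"
      using lim
    proof eventually_elim
      case (elim x)
      then have "\<forall>\<^sub>F n in sequentially. \<bar>f n x\<bar> < c"
        using c by (auto dest!: tendstoD simp: dist_real_def)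
      then show ?case
        by (intro tendsto_eventually, elim eventually_mono) (auto simp: indicator_def)
    qed
  qed (use fin in \<open>auto simp: indicator_def\<close>)
  then show ?thesis
    by (simp add: MO_measure_def)
qed

text \<open>Non-strict bounds by real \<open>e\<close> suffice: by density some finite
  \<open>b\<close> lies strictly between 0 and \<open>a\<close>, even if \<open>a\<close> is
  infinite.\<close>

lemma tendsto_0_if_eventually_le_ennreal:
  fixes f :: "'a \<Rightarrow> ennreal"
  assumes "\<And>e. 0 < e \<Longrightarrow> \<forall>\<^sub>F x in F. f x \<le> ennreal e"
  shows "(f \<longlongrightarrow> 0) F"
proof (rule order_tendstoI)
  fix a :: ennreal assume "0 < a"
  then obtain b where b: "0 < b" "b < a"
    using dense by blast
  then obtain e where "b = ennreal e" "0 < e"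
    by (cases b) auto
  with b show "\<forall>\<^sub>F x in F. f x < a"
    using assms[of e] by (auto elim!: eventually_mono)
qed simp

theorem theorem5p9:
  fixes M :: "'a measure"
    and \<phi> :: "'a \<Rightarrow> real \<Rightarrow> real"
    and p_lower p_upper :: real
    and h_seq :: "nat \<Rightarrow> 'a \<Rightarrow> real"
    and h g :: "'a \<Rightarrow> real"
  assumes "prob_space M"
    and "Musielak_Orlicz M \<phi>"
    and "0 < p_lower" and "uniformly_lower_type M \<phi> p_lower"
    and "0 < p_upper" and "uniformly_upper_type M \<phi> p_upper"
    and "\<And>t. 0 < t \<Longrightarrow> (\<integral>\<^sup>+x. ennreal (\<phi> x t) \<partial>M) < top"
    and "\<And>n. h_seq n \<in> borel_measurable M"
    and "h \<in> borel_measurable M"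
    and "AE x in M. (\<lambda>n. h_seq n x) \<longlonglongrightarrow> h x"
    and "g \<in> WL_abs_cont M \<phi>"
    and "\<And>n. AE x in M. \<bar>h_seq n x\<bar> \<le> g x"
  shows "(\<lambda>n. WL_norm M \<phi> (\<lambda>x. h_seq n x - h x)) \<longlonglongrightarrow> 0"
proof (rule tendsto_0_if_eventually_le_ennreal)
  fix \<epsilon> :: real assume \<epsilon>: "0 < \<epsilon>"
  let ?d = "\<lambda>n x. h_seq n x - h x"
  let ?G = "\<lambda>N x. g x * indicator {x \<in> space M. \<bar>g x\<bar> > real N} x"
  note MO = assms(2) and [measurable] = assms(8,9)

  have "AE x in M. \<forall>n. \<bar>h_seq n x\<bar> \<le> g x"
    using assms(12) by (simp add: AE_all_countable)
  then have bound: "AE x in M. \<forall>n. \<bar>?d n x\<bar> \<le> 2 * g x"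
    using assms(10)
  proof eventually_elim
    case (elim x)
    have "\<bar>h x\<bar> \<le> g x"
      by (rule LIMSEQ_le_const2[OF tendsto_rabs[OF elim(2)]]) (use elim(1) in auto)
    show ?case
    proof
      fix m
      show "\<bar>?d m x\<bar> \<le> 2 * g x"
        using \<open>\<bar>h x\<bar> \<le> g x\<close> elim(1)[rule_format, of m] by linarith
    qed
  qed

  have "(\<lambda>N. WL_norm M \<phi> (?G N)) \<longlonglongrightarrow> 0"
    using assms(11) by (simp add: WL_abs_cont_def)
  \<comment> \<open>The half compensates the factor 2 in \<open>bound\<close>:
    \<open>l < \<epsilon> / 2\<close> gives
    \<open>\<alpha> / \<epsilon> \<le> (\<alpha> / 2) / l\<close>.\<close>
  then have "\<forall>\<^sub>F N in sequentially. WL_norm M \<phi> (?G N) < ennreal (\<epsilon> / 2)"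
    using \<epsilon> by (intro order_tendstoD) auto
  then obtain N where "WL_norm M \<phi> (?G N) < ennreal (\<epsilon> / 2)"
    by (auto simp: eventually_sequentially)
  then obtain l where l: "0 < l" "l < \<epsilon> / 2"
    and Gl: "\<And>\<alpha>. 0 < \<alpha> \<Longrightarrow> MO_measure M \<phi> {x \<in> space M. \<bar>?G N x\<bar> > \<alpha>} (\<alpha> / l) \<le> 1"
    by (rule WL_norm_lessE) blast

  have "\<forall>\<^sub>F s in at_right 0. MO_measure M \<phi> (space M) s < 1"
    using MO_measure_space_tendsto_0[OF MO assms(3,4) assms(7)[of 1]] by (intro order_tendstoD) auto
  moreover have "\<forall>\<^sub>F s :: real in at_right 0. 0 < s"
    by (rule eventually_at_right_less)
  ultimately have "\<forall>\<^sub>F s in at_right 0. 0 < s \<and> MO_measure M \<phi> (space M) s < 1"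
    by eventually_elim simp
  \<comment> \<open>This fixes the threshold \<open>s * \<epsilon>\<close> for small
    \<open>\<alpha>\<close>: below it, \<open>\<alpha> / \<epsilon> \<le> s\<close>. Its positivity
    makes it a legitimate level for the superlevel lemma.\<close>
  then obtain s where s: "0 < s" "MO_measure M \<phi> (space M) s < 1"
    using eventually_happens[of _ "at_right (0::real)"] by auto

  \<comment> \<open>\<open>T\<close> exceeds \<open>\<alpha> / \<epsilon>\<close> for all
    \<open>\<alpha> < 2 * N\<close>; the added 1 keeps it positive when
    \<open>N = 0\<close>.\<close>
  define T where "T = 2 * (real N + 1) / \<epsilon>"
  have T: "0 < T"
    using \<epsilon> by (simp add: T_def)
  have "AE x in M. (\<lambda>n. ?d n x) \<longlonglongrightarrow> 0"
    using assms(10) by eventually_elim (rule LIM_zero)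
  then have "(\<lambda>n. MO_measure M \<phi> {x \<in> space M. \<bar>?d n x\<bar> > s * \<epsilon>} T) \<longlonglongrightarrow> 0"
    using T s \<epsilon> assms(7) by (intro MO_measure_superlevel_tendsto_0[OF MO]) auto
  then have "\<forall>\<^sub>F n in sequentially. MO_measure M \<phi> {x \<in> space M. \<bar>?d n x\<bar> > s * \<epsilon>} T < 1"
    by (intro order_tendstoD) auto
  \<comment> \<open>Neither \<open>s * \<epsilon>\<close> nor \<open>T\<close> depends on
    \<open>\<alpha>\<close>, so one \<open>n\<close> serves all \<open>\<alpha>\<close> at
    once.\<close>
  then show "\<forall>\<^sub>F n in sequentially. WL_norm M \<phi> (?d n) \<le> ennreal \<epsilon>"
  proof eventually_elim
    case (elim n)
    show ?case
    proof (rule WL_norm_le[OF \<epsilon>])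
      fix \<alpha> :: real assume \<alpha>: "0 < \<alpha>"
      let ?A = "{x \<in> space M. \<bar>?d n x\<bar> > \<alpha>}"
      consider "\<alpha> \<le> s * \<epsilon>" | "s * \<epsilon> < \<alpha>" "\<alpha> < 2 * N" | "2 * N \<le> \<alpha>"
        by linarith
      then show "MO_measure M \<phi> ?A (\<alpha> / \<epsilon>) \<le> 1"
      proof cases
        case 1
        have "MO_measure M \<phi> ?A (\<alpha> / \<epsilon>) \<le> MO_measure M \<phi> (space M) s"
          using 1 \<alpha> \<epsilon> by (intro MO_measure_mono_AE[OF MO]) (auto simp: field_simps)
        then show ?thesis
          using s(2) by simp
      next
        case 2
        \<comment> \<open>Lowering the level to \<open>s * \<epsilon>\<close> enlarges the set, and
          raising the argument to \<open>T\<close> enlarges the integrand.\<close>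
        have "MO_measure M \<phi> ?A (\<alpha> / \<epsilon>) \<le> MO_measure M \<phi> {x \<in> space M. \<bar>?d n x\<bar> > s * \<epsilon>} T"
          using 2 \<alpha> \<epsilon> by (intro MO_measure_mono_AE[OF MO]) (auto simp: T_def divide_right_mono)
        then show ?thesis
          using elim by simp
      next
        case 3
        have "MO_measure M \<phi> ?A (\<alpha> / \<epsilon>)
            \<le> MO_measure M \<phi> {x \<in> space M. \<bar>?G N x\<bar> > \<alpha> / 2} (\<alpha> / 2 / l)"
        proof (rule MO_measure_mono_AE[OF MO])
          show "\<alpha> / \<epsilon> \<le> \<alpha> / 2 / l"
            using \<alpha> \<epsilon> l by (simp add: field_simps)
          show "AE x in M. x \<in> ?A \<longrightarrow> x \<in> {x \<in> space M. \<bar>?G N x\<bar> > \<alpha> / 2}"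
            using bound
          proof eventually_elim
            case (elim x)
            \<comment> \<open>On \<open>?A\<close> this gives
              \<open>g x > \<alpha> / 2 \<ge> N\<close>, so the truncation \<open>?G N\<close>
              agrees with \<open>g\<close> there.\<close>
            then have "\<bar>?d n x\<bar> \<le> 2 * g x"
              by blast
            then show ?case
              using 3 by (auto simp: indicator_def)
          qed
        qed (use \<alpha> \<epsilon> in simp)
        also have "\<dots> \<le> 1"
          using \<alpha> by (intro Gl) simp
        finally show ?thesis .
      qed
    qed
  qed
qed

end
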